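(* Let $\mathcal{M}=(\mathbb{Z}_n,\mathcal{B})$ be a cyclic $k$-matroid, and for $j\in\mathbb{Z}_n$ let $B_j=\{j,j+1,\ldots,j+k-1\}$ (modulo $n$), so $B_0=\{0,1,\ldots,k-1\}$. Then there are at least $m_1(n,k)$ distinct bases in $\mathcal{B}$ of the form $(B_0\setminus Q)\cup P$, where $Q\subseteq B_0$ and $P\subseteq B_i$ for some $1\le i\le n-1$, where $$m_1(n,k)=1+\sum_{\Delta=0}^{\min(k-1,\,n-k-1)}\ \sum_{r=1}^{\Delta+1}(k-\Delta)\binom{\Delta-1}{r-2}\left(\left\lfloor\frac{n-k-\Delta-1}{k-r+1}\right\rfloor+1\right).$$
   Context: The ground set is $\mathbb{Z}_n=\{0,1,\ldots,n-1\}$ with arithmetic modulo $n$; for $s\in\mathbb{Z}_n$ and $A\subseteq\mathbb{Z}_n$, $s+A=\{s+a:a\in A\}$. A matroid $\mathcal{M}=(\mathbb{Z}_n,\mathcal{B})$ (given by its set of bases $\mathcal{B}$) is a cyclic $k$-matroid if it has rank $k$ and $A\in\mathcal{B}$ implies $s+A\in\mathcal{B}$ for all $s\in\mathbb{Z}_n$. Binomial coefficient convention: $\binom{a}{-1}=0$ if $a\ge 0$ and $\binom{-1}{-1}=1$; other binomial coefficients are the usual ones for $a\ge 0$.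
   Formalization: The formal theorem assumes n ≥ 2: for n = 1 the index range 1 ≤ i ≤ n−1 is empty, so no basis has the stated form although m_1(1,k) = 1. *)

theory Defs imports Complex_Main begin

definition matroid_bases :: "'a set \<Rightarrow> 'a set set \<Rightarrow> bool" where
  "matroid_bases E \<B> \<longleftrightarrow>
     finite E \<and> \<B> \<noteq> {} \<and> (\<forall>A\<in>\<B>. A \<subseteq> E) \<and>
     (\<forall>A\<in>\<B>. \<forall>B\<in>\<B>. \<forall>x\<in>A - B. \<exists>y\<in>B - A. insert y (A - {x}) \<in> \<B>)"

text \<open>The residues modulo \<open>n\<close> are represented by the naturals below \<open>n\<close>.\<close>

definition cyc_shift :: "nat \<Rightarrow> nat \<Rightarrow> nat set \<Rightarrow> nat set" where
  "cyc_shift n s A = (\<lambda>a. (s + a) mod n) ` A"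

definition cyclic_matroid :: "nat \<Rightarrow> nat \<Rightarrow> nat set set \<Rightarrow> bool" where
  "cyclic_matroid n k \<B> \<longleftrightarrow>
     matroid_bases {0..<n} \<B> \<and> (\<forall>A\<in>\<B>. card A = k) \<and>
     (\<forall>A\<in>\<B>. \<forall>s\<in>{0..<n}. cyc_shift n s A \<in> \<B>)"

definition cyc_block :: "nat \<Rightarrow> nat \<Rightarrow> nat \<Rightarrow> nat set" where
  "cyc_block n k j = (\<lambda>t. (j + t) mod n) ` {0..<k}"

text \<open>Binomial coefficients with \<open>(a choose -1) = 0\<close> for \<open>a \<ge> 0\<close> and \<open>(-1 choose -1) = 1\<close>;
  only \<open>a \<ge> 0\<close> with \<open>b \<ge> -1\<close>, and \<open>a = b = -1\<close>, are meaningful arguments.\<close>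

definition ext_binom :: "int \<Rightarrow> int \<Rightarrow> int" where
  "ext_binom a b = (if b = -1 then (if a = -1 then 1 else 0) else int (nat a choose nat b))"

text \<open>Everything is computed in the integers, so that no subtraction truncates; the outer sum is
  empty if \<open>k = 0\<close> or \<open>k = n\<close>.\<close>

definition m1 :: "nat \<Rightarrow> nat \<Rightarrow> int" where
  "m1 n k = 1 + (\<Sum>\<Delta> = 0..min (int k - 1) (int n - int k - 1). \<Sum>r = 1..\<Delta> + 1.
     (int k - \<Delta>) * ext_binom (\<Delta> - 1) (r - 2) *
     (\<lfloor>real_of_int (int n - int k - \<Delta> - 1) / real_of_int (int k - r + 1)\<rfloor> + 1))"

end

theory Submission imports Defs begin

text \<open>
  Every block of \<open>k\<close> consecutive residues is a basis: if \<open>{0..<j}\<close> is independent but \<open>{0..j}\<close> is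
  not, then by shift invariance each new residue lies in the span of the \<open>j\<close> preceding ones, so the
  rank never exceeds \<open>j\<close>.

  Fix a nonempty \<open>Q \<subseteq> {0..<k}\<close> of size \<open>r\<close>, with minimum \<open>q\<close> and maximum \<open>q + \<Delta>\<close>. For
  \<open>i = q + \<Delta> + 1 + t (k - r + 1)\<close>, where \<open>0 \<le> t \<le> (n - k - \<Delta> - 1) div (k - r + 1)\<close>, the
  block \<open>B\<^sub>i\<close> starts after the maximum of \<open>Q\<close> and ends before its minimum is reached again, so it
  avoids \<open>Q\<close>. Extending \<open>B\<^sub>0 - Q\<close> by elements of \<open>B\<^sub>i\<close> gives a basis meeting \<open>B\<^sub>0\<close> exactly in
  \<open>B\<^sub>0 - Q\<close>, which therefore determines \<open>Q\<close>; it determines \<open>t\<close> as well, since two of these blocks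
  share at most \<open>r - 1\<close> elements while \<open>r\<close> new elements are used.
\<close>

section \<open>Extension and augmentation of independent sets\<close>

lemma matroid_bases_finite:
  assumes "matroid_bases E \<B>" "A \<in> \<B>"
  shows "finite A"
proof -
  have "finite E" "A \<subseteq> E" using assms by (simp_all add: matroid_bases_def)
  then show ?thesis by (rule finite_subset[rotated])
qed

lemma matroid_bases_exchange:
  assumes "matroid_bases E \<B>" "A \<in> \<B>" "B \<in> \<B>" "x \<in> A" "x \<notin> B"
  obtains y where "y \<in> B - A" "insert y (A - {x}) \<in> \<B>"
proof -
  have "\<forall>A\<in>\<B>. \<forall>B\<in>\<B>. \<forall>x\<in>A - B. \<exists>y\<in>B - A. insert y (A - {x}) \<in> \<B>"
    using assms(1) unfolding matroid_bases_def by (elim conjE)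
  then have "\<exists>y\<in>B - A. insert y (A - {x}) \<in> \<B>" using assms(2-5) by simp
  then show thesis using that by (elim bexE)
qed

text \<open>Exchanging an element of \<open>A\<close> outside \<open>I \<union> B\<close> for one of
  \<open>B\<close> keeps \<open>I\<close> inside the basis and lowers the number of such elements,
  so the process ends within \<open>I \<union> B\<close>.\<close>

lemma matroid_bases_extend:
  assumes M: "matroid_bases E \<B>" and A: "A \<in> \<B>" and B: "B \<in> \<B>" and I: "I \<subseteq> A"
  shows "\<exists>C\<in>\<B>. I \<subseteq> C \<and> C \<subseteq> I \<union> B"
  using A I
proof (induction "card (A - (I \<union> B))" arbitrary: A rule: less_induct)
  case less
  show ?case
  proof (cases "A \<subseteq> I \<union> B")
    case True
    then show ?thesis using less.prems by (intro bexI[of _ A] conjI)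
  next
    case False
    then obtain x where x: "x \<in> A" "x \<notin> I" "x \<notin> B" by blast
    have fin: "finite A" by (rule matroid_bases_finite[OF M less.prems(1)])
    obtain y where y: "y \<in> B - A" and C: "insert y (A - {x}) \<in> \<B>"
      using matroid_bases_exchange[OF M less.prems(1) B x(1,3)] .
    have "insert y (A - {x}) - (I \<union> B) \<subseteq> A - (I \<union> B)"
      "x \<in> A - (I \<union> B)" "x \<notin> insert y (A - {x}) - (I \<union> B)" using x y by auto
    then have "insert y (A - {x}) - (I \<union> B) \<subset> A - (I \<union> B)" by blast
    then have "card (insert y (A - {x}) - (I \<union> B)) < card (A - (I \<union> B))"
      using fin by (intro psubset_card_mono) auto
    moreover have "I \<subseteq> insert y (A - {x})" using less.prems(2) x by blast
    ultimately show ?thesis by (rule less.hyps[OF _ C])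
  qed
qed

text \<open>Extend \<open>I\<close> by elements of \<open>A\<close> to a basis \<open>C\<close>. If
  no element of \<open>J\<close> could be added to \<open>I\<close>, then \<open>C\<close> would lie
  in \<open>I \<union> (A - J)\<close>, which has fewer than \<open>k\<close> elements.\<close>

lemma matroid_bases_augment:
  assumes M: "matroid_bases E \<B>" and card: "\<And>A. A \<in> \<B> \<Longrightarrow> card A = k"
    and D: "D \<in> \<B>" "I \<subseteq> D" and A: "A \<in> \<B>" "J \<subseteq> A" and lt: "card I < card J"
  shows "\<exists>x\<in>J - I. \<exists>C\<in>\<B>. insert x I \<subseteq> C"
proof (rule ccontr)
  assume no: "\<not> ?thesis"
  obtain C where C: "C \<in> \<B>" "I \<subseteq> C" "C \<subseteq> I \<union> A"
    using matroid_bases_extend[OF M D(1) A(1) D(2)] by blast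
  have fin: "finite A" "finite I" "finite J"
    using matroid_bases_finite[OF M A(1)] matroid_bases_finite[OF M D(1)] A(2) D(2) finite_subset
    by blast+
  have "C \<subseteq> I \<union> (A - J)" using no C by blast
  then have "card C \<le> card (I \<union> (A - J))" using fin by (intro card_mono) auto
  also have "\<dots> \<le> card I + card (A - J)" by (rule card_Un_le)
  also have "\<dots> = card I + (card A - card J)" using fin A(2) by (simp add: card_Diff_subset)
  finally show False
    using card[OF C(1)] card[OF A(1)] lt card_mono[OF fin(1) A(2)] by linarith
qed

section \<open>Cyclic shifts of sets and bases\<close>

lemma cyc_shift_in_cyclic_matroid:
  assumes M: "cyclic_matroid n k \<B>" and A: "A \<in> \<B>" and n: "0 < n"
  shows "cyc_shift n s A \<in> \<B>"
proof -
  have "cyc_shift n s A = cyc_shift n (s mod n) A"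
    unfolding cyc_shift_def by (simp add: mod_add_left_eq)
  also have "\<dots> \<in> \<B>" using M A n unfolding cyclic_matroid_def by simp
  finally show ?thesis .
qed

lemma cyc_shift_atLeastLessThan:
  assumes "s + b \<le> n"
  shows "cyc_shift n s {a..<b} = {s + a..<s + b}"
proof -
  have "cyc_shift n s {a..<b} = (+) s ` {a..<b}"
    unfolding cyc_shift_def using assms by (intro image_cong) auto
  then show ?thesis by (simp add: add.commute)
qed

lemma cyc_shift_back:
  assumes "A \<subseteq> {0..<n}" "s \<le> n"
  shows "cyc_shift n (n - s) (cyc_shift n s A) = A"
proof -
  have "(n - s + (s + a) mod n) mod n = a" if "a \<in> A" for a
  proof -
    have "(n - s + (s + a) mod n) mod n = (n - s + (s + a)) mod n" by (rule mod_add_right_eq)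
    also have "n - s + (s + a) = n + a" using assms(2) by simp
    also have "(n + a) mod n = a" using assms(1) that by auto
    finally show ?thesis .
  qed
  then show ?thesis unfolding cyc_shift_def image_image by simp
qed

lemma cyc_shift_mono: "A \<subseteq> B \<Longrightarrow> cyc_shift n s A \<subseteq> cyc_shift n s B"
  unfolding cyc_shift_def by (rule image_mono)

lemma cyclic_matroid_rank_le:
  assumes M: "cyclic_matroid n k \<B>" and "A \<in> \<B>"
  shows "k \<le> n"
proof -
  have "A \<subseteq> {0..<n}" "card A = k"
    using assms by (simp_all add: cyclic_matroid_def matroid_bases_def)
  then show ?thesis using card_mono[of "{0..<n}" A] by simp
qed

section \<open>Blocks of consecutive residues are bases\<close>

lemma initial_block_in_cyclic_matroid:
  assumes M: "cyclic_matroid n k \<B>" and n: "0 < n"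
  shows "{0..<k} \<in> \<B>"
proof -
  have mat: "matroid_bases {0..<n} \<B>" and card: "\<And>A. A \<in> \<B> \<Longrightarrow> card A = k"
    using M by (simp_all add: cyclic_matroid_def)
  have "\<B> \<noteq> {}" using mat by (simp add: matroid_bases_def)
  then obtain A0 where A0: "A0 \<in> \<B>" by blast
  have sub: "A \<subseteq> {0..<n}" if "A \<in> \<B>" for A
    using mat that by (simp add: matroid_bases_def)
  have fin: "finite A" if "A \<in> \<B>" for A by (rule matroid_bases_finite[OF mat that])
  define P where "P j \<longleftrightarrow> (\<exists>D\<in>\<B>. {0..<j} \<subseteq> D)" for j
  have Pk: "j \<le> k" if "P j" for j
  proof -
    obtain D where "D \<in> \<B>" "{0..<j} \<subseteq> D" using \<open>P j\<close> unfolding P_def by (elim bexE)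
    then show ?thesis using card_mono[of D "{0..<j}"] card fin by simp
  qed
  have P0: "P 0" using A0 unfolding P_def by auto
  \<comment> \<open>\<open>P i\<close> expresses independence of \<open>{0..<i}\<close>. A greatest
    such \<open>i\<close> exists because \<open>P 0\<close> holds and \<open>Pk\<close> bounds all
    of them by \<open>k\<close>.\<close>
  define j where "j = (GREATEST i. P i)"
  have j: "P j" "\<And>i. P i \<Longrightarrow> i \<le> j"
    unfolding j_def using GreatestI_nat[of P 0 k] Greatest_le_nat[of P _ k] P0 Pk by simp_all
  obtain D where D: "D \<in> \<B>" "{0..<j} \<subseteq> D" using j(1) unfolding P_def by blast
  show ?thesis
  proof (cases "j = k")
    case True
    have "{0..<k} = D" using D True card[OF D(1)] fin[OF D(1)] by (intro card_subset_eq) auto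
    then show ?thesis using D by simp
  next
    case False
    then have jk: "j < k" using Pk[OF j(1)] by simp
    have kn: "k \<le> n" using cyclic_matroid_rank_le[OF M A0] .
    \<comment> \<open>This bounds the rank of \<open>{0..<m}\<close> by \<open>j\<close>. The basis
      stays arbitrary in the induction because the hypothesis is applied to the augmented basis
      \<open>C\<close>, not to \<open>A\<close>.\<close>
    have "card (A \<inter> {0..<m}) \<le> j" if "m \<le> n" "A \<in> \<B>" for m A
      using that
    proof (induction m arbitrary: A)
      case (Suc m)
      show ?case
      proof (rule ccontr)
        assume big: "\<not> ?thesis"
        have "card (A \<inter> {0..<Suc m}) \<le> card {0..<Suc m}" by (intro card_mono) auto
        then have jm: "j \<le> m" using big by simp
        let ?I = "{m - j..<m}"
        have Ish: "?I = cyc_shift n (m - j) {0..<j}"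
          using Suc.prems(1) jm by (subst cyc_shift_atLeastLessThan) auto
        let ?D = "cyc_shift n (m - j) D"
        have D': "?D \<in> \<B>" "?I \<subseteq> ?D"
          unfolding Ish using cyc_shift_in_cyclic_matroid[OF M D(1) n] cyc_shift_mono[OF D(2)] by auto
        have "card ?I < card (A \<inter> {0..<Suc m})" using big jm by simp
        then obtain x C where x: "x \<in> A \<inter> {0..<Suc m} - ?I" and C: "C \<in> \<B>" "insert x ?I \<subseteq> C"
          using matroid_bases_augment[OF mat card D'(1) D'(2) Suc.prems(2), of "A \<inter> {0..<Suc m}"]
          by blast
        \<comment> \<open>If \<open>x = m\<close>, then \<open>j + 1\<close> consecutive residues
          are independent, and shifting them back to 0 contradicts the maximality of
          \<open>j\<close>. Otherwise \<open>C\<close> has \<open>j + 1\<close> elements below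
          \<open>m\<close>, against the induction hypothesis.\<close>
        show False
        proof (cases "x = m")
          case True
          then have "{m - j..<Suc m} \<subseteq> C" using C(2) by (auto simp: less_Suc_eq)
          moreover have "{m - j..<Suc m} = cyc_shift n (m - j) {0..<Suc j}"
            using Suc.prems(1) jm by (subst cyc_shift_atLeastLessThan) auto
          ultimately have "cyc_shift n (m - j) {0..<Suc j} \<subseteq> C" by simp
          then have "cyc_shift n (n - (m - j)) (cyc_shift n (m - j) {0..<Suc j})
              \<subseteq> cyc_shift n (n - (m - j)) C" by (rule cyc_shift_mono)
          moreover have "cyc_shift n (n - (m - j)) (cyc_shift n (m - j) {0..<Suc j}) = {0..<Suc j}"
            using jk kn Suc.prems(1) by (intro cyc_shift_back) auto
          ultimately have "P (Suc j)"
            using cyc_shift_in_cyclic_matroid[OF M C(1) n, of "n - (m - j)"] unfolding P_def by auto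
          then show False using j(2)[of "Suc j"] by simp
        next
          case False
          then have "insert x ?I \<subseteq> C \<inter> {0..<m}" using C(2) x by auto
          then have "card (insert x ?I) \<le> card (C \<inter> {0..<m})" by (intro card_mono) auto
          moreover have "card (insert x ?I) = Suc j" using x jm by simp
          ultimately show False using Suc.IH[OF _ C(1)] Suc.prems(1) by simp
        qed
      qed
    qed simp
    \<comment> \<open>At \<open>m = n\<close> the bound applies to the whole of \<open>A0\<close>,
      whose size is \<open>k > j\<close>.\<close>
    from this[of n A0] have "card A0 \<le> j" using A0 sub[OF A0] by (simp add: Int_absorb2)
    then show ?thesis using card[OF A0] jk by simp
  qed
qed

lemma cyc_block_in_cyclic_matroid:
  assumes "cyclic_matroid n k \<B>" "0 < n"
  shows "cyc_block n k j \<in> \<B>"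
  using cyc_shift_in_cyclic_matroid[OF assms(1) initial_block_in_cyclic_matroid[OF assms] assms(2), of j]
  unfolding cyc_shift_def cyc_block_def .

section \<open>Overlaps of cyclic blocks\<close>

lemma mod_eq_within_period:
  fixes x y n a :: nat
  assumes "x mod n = y mod n" "a \<le> x" "x < a + n" "a \<le> y" "y < a + n"
  shows "x = y"
proof -
  have *: "u = v" if "u mod n = v mod n" "a \<le> u" "u \<le> v" "v < a + n" for u v
  proof -
    have "n dvd v - u" using that mod_eq_dvd_iff_nat[of u v n] by simp
    then show ?thesis using that by (auto dest: dvd_imp_le)
  qed
  show ?thesis using *[of x y] *[of y x] assms by (cases "x \<le> y") auto
qed

text \<open>Before reduction modulo \<open>n\<close>, the block and \<open>Q\<close> both lie in the
  single period \<open>{q..<q + n}\<close>, so a common residue would be a common integer; but the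
  block starts beyond \<open>q + d\<close>.\<close>

lemma cyc_block_avoids:
  assumes Q: "Q \<subseteq> {q..q + d}" and "q + d < i" "i + k \<le> n + q" "q + d < n"
  shows "cyc_block n k i \<inter> Q = {}"
proof (rule ccontr)
  assume "\<not> ?thesis"
  then obtain x t where x: "x \<in> Q" "t < k" "x = (i + t) mod n"
    unfolding cyc_block_def by fastforce
  then have "x mod n = (i + t) mod n" by simp
  then have "x = i + t" using x assms by (intro mod_eq_within_period[of x n _ q]) auto
  then show False using x Q assms by auto
qed

text \<open>Both unreduced blocks lie in the period starting at \<open>q\<close>, so common residues
  come only from the integer overlap \<open>{j..<i + k}\<close>.\<close>

lemma card_cyc_block_Int:
  assumes "q < i" "i \<le> j" "j + k \<le> n + q"
  shows "card (cyc_block n k i \<inter> cyc_block n k j) \<le> i + k - j"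
proof -
  have "cyc_block n k i \<inter> cyc_block n k j \<subseteq> (\<lambda>x. x mod n) ` {j..<i + k}"
  proof
    fix x assume "x \<in> cyc_block n k i \<inter> cyc_block n k j"
    then obtain u v where uv: "u < k" "x = (i + u) mod n" "v < k" "x = (j + v) mod n"
      unfolding cyc_block_def by auto
    have "i + u = j + v"
    proof (rule mod_eq_within_period[of _ n _ q])
      show "(i + u) mod n = (j + v) mod n" using uv(2,4) by (rule trans[OF sym])
    qed (use uv(1,3) assms in linarith)+
    then show "x \<in> (\<lambda>x. x mod n) ` {j..<i + k}" using uv by (intro image_eqI[of _ _ "i + u"]) auto
  qed
  then have "card (cyc_block n k i \<inter> cyc_block n k j) \<le> card ((\<lambda>x. x mod n) ` {j..<i + k})"
    by (intro card_mono) auto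
  also have "\<dots> \<le> card {j..<i + k}" by (rule card_image_le) simp
  finally show ?thesis by simp
qed

section \<open>Exchanging part of the initial block for elements of a later one\<close>

text \<open>Extending \<open>{0..<k} - Q\<close> by the later block cannot restore anything from
  \<open>Q\<close>, because that block avoids \<open>Q\<close>.\<close>

lemma exchange_with_cyc_block:
  assumes M: "cyclic_matroid n k \<B>" and Q: "Q \<subseteq> {q..q + d}"
    and i: "q + d < i" "i + k \<le> n + q" and qd: "q + d < k"
  shows "\<exists>C\<in>\<B>. {0..<k} - C = Q \<and> C \<subseteq> {0..<k} \<union> cyc_block n k i"
proof -
  have n: "0 < n" "q + d < n" using i qd by auto
  have "x < k" if "x \<in> Q" for x using Q that qd by fastforce
  then have Qk: "Q \<subseteq> {0..<k}" by auto
  have mat: "matroid_bases {0..<n} \<B>" using M unfolding cyclic_matroid_def by simp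
  obtain C where C: "C \<in> \<B>" "{0..<k} - Q \<subseteq> C" "C \<subseteq> ({0..<k} - Q) \<union> cyc_block n k i"
    using matroid_bases_extend[OF mat initial_block_in_cyclic_matroid[OF M n(1)]
        cyc_block_in_cyclic_matroid[OF M n(1), of i] Diff_subset[of _ Q]] by (elim bexE conjE)
  have avoid: "cyc_block n k i \<inter> Q = {}" by (rule cyc_block_avoids[OF Q i n(2)])
  have "{0..<k} - C = Q"
  proof
    show "{0..<k} - C \<subseteq> Q" using C(2) by blast
    show "Q \<subseteq> {0..<k} - C" using C(3) Qk avoid by blast
  qed
  moreover have "C \<subseteq> {0..<k} \<union> cyc_block n k i" using C(3) by blast
  ultimately show ?thesis using C(1) by (intro bexI[of _ C] conjI)
qed

text \<open>Since \<open>C\<close> and \<open>{0..<k}\<close> have equal size, \<open>C\<close>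
  gains as many elements as it loses, and all gained elements lie in both blocks. This later rules
  out that one basis arises from two different blocks.\<close>

lemma exchange_block_unique:
  assumes M: "cyclic_matroid n k \<B>" and C: "C \<in> \<B>"
    and Ci: "C \<subseteq> {0..<k} \<union> cyc_block n k i" and Cj: "C \<subseteq> {0..<k} \<union> cyc_block n k j"
    and ij: "q < i" "i \<le> j" "j + k \<le> n + q"
  shows "card ({0..<k} - C) \<le> i + k - j"
proof -
  have cardC: "card C = k" and fin: "finite C"
    using M C matroid_bases_finite unfolding cyclic_matroid_def by blast+
  have "card ({0..<k} - C) = card (C - {0..<k})"
    using fin cardC by (simp add: card_Diff_subset_Int Int_commute)
  also have "\<dots> \<le> card (cyc_block n k i \<inter> cyc_block n k j)"
    using Ci Cj by (intro card_mono) (auto simp: cyc_block_def)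
  also have "\<dots> \<le> i + k - j" using ij by (rule card_cyc_block_Int)
  finally show ?thesis .
qed

section \<open>Counting the removed sets and rewriting the bound\<close>

text \<open>The candidates for \<open>Q\<close>, sorted by least element, width and size;
  \<open>d\<close> is the \<Delta> of the formula. Spanning refers to the extent on the number line,
  not to matroid span.\<close>

definition spanning_subsets :: "nat \<Rightarrow> nat \<Rightarrow> nat \<Rightarrow> nat set set" where
  "spanning_subsets d r q = {Q. Q \<subseteq> {q..q + d} \<and> q \<in> Q \<and> q + d \<in> Q \<and> card Q = r}"

lemma finite_spanning_subsets: "finite (spanning_subsets d r q)"
  unfolding spanning_subsets_def by (rule finite_subset[of _ "Pow {q..q + d}"]) auto

lemma spanning_subsets_Min_Max:
  assumes "Q \<in> spanning_subsets d r q"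
  shows "Min Q = q" "Max Q = q + d"
proof -
  have Q: "Q \<subseteq> {q..q + d}" "q \<in> Q" "q + d \<in> Q" using assms unfolding spanning_subsets_def by auto
  have "finite Q" using Q(1) finite_subset by blast
  then show "Min Q = q" "Max Q = q + d" using Q by (auto intro!: Min_eqI Max_eqI)
qed

text \<open>Once both endpoints are fixed, the other \<open>r - 2\<close> elements are free among
  \<open>d - 1\<close> interior positions. For \<open>d = 0\<close> the endpoints coincide, and the
  single set \<open>{q}\<close> matches the convention for -1 over -1.\<close>

lemma ext_binom_le_card_spanning_subsets:
  assumes "1 \<le> r" "r \<le> d + 1"
  shows "ext_binom (int d - 1) (int r - 2) \<le> int (card (spanning_subsets d r q))"
proof (cases "d = 0")
  case True
  then have "spanning_subsets d r q = {{q}}" using assms unfolding spanning_subsets_def by auto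
  then show ?thesis using True assms by (simp add: ext_binom_def)
next
  case False
  show ?thesis
  proof (cases "r = 1")
    case True
    then show ?thesis using False by (simp add: ext_binom_def)
  next
    case r: False
    define F where "F = {T. T \<subseteq> {q<..<q + d} \<and> card T = r - 2}"
    let ?g = "\<lambda>T. insert q (insert (q + d) T)"
    have "inj_on ?g F"
    proof (rule inj_onI)
      fix S T assume ST: "S \<in> F" "T \<in> F" and eq: "?g S = ?g T"
      have "?g U - {q, q + d} = U" if "U \<in> F" for U using that unfolding F_def by auto
      then show "S = T" using ST eq by metis
    qed
    moreover have "?g ` F \<subseteq> spanning_subsets d r q"
    proof (rule image_subsetI)
      fix T assume T: "T \<in> F"
      then have "finite T" "q \<notin> T" "q + d \<notin> T" "T \<subseteq> {q..q + d}"
        unfolding F_def by (auto intro: finite_subset)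
      then show "?g T \<in> spanning_subsets d r q"
        using T False r assms(1) unfolding F_def spanning_subsets_def by auto
    qed
    ultimately have "card F \<le> card (spanning_subsets d r q)"
      using finite_spanning_subsets by (intro card_inj_on_le) auto
    moreover have "card F = (d - 1) choose (r - 2)"
      unfolding F_def using n_subsets[of "{q<..<q + d}" "r - 2"] by simp
    moreover have "nat (int d - 1) = d - 1" "nat (int r - 2) = r - 2" by auto
    ultimately show ?thesis using False r assms(1) by (simp add: ext_binom_def)
  qed
qed

text \<open>Within the summation range \<open>d < k\<close>, \<open>d < n - k\<close> and
  \<open>r \<le> k\<close>, so no natural subtraction outside the binomial truncates and the floor
  is a natural quotient.\<close>

lemma m1_eq_nat_sum:
  assumes "k \<le> n"
  shows "m1 n k = 1 + (\<Sum>d<min k (n - k). \<Sum>r=1..d + 1.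
     int (k - d) * ext_binom (int d - 1) (int r - 2) *
     int ((n - k - d - 1) div (k - r + 1) + 1))"
proof -
  have inner: "(\<Sum>r = 1..int d + 1. (int k - int d) * ext_binom (int d - 1) (r - 2) *
       (\<lfloor>real_of_int (int n - int k - int d - 1) / real_of_int (int k - r + 1)\<rfloor> + 1))
    = (\<Sum>r=1..d + 1. int (k - d) * ext_binom (int d - 1) (int r - 2) *
       int ((n - k - d - 1) div (k - r + 1) + 1))" if d: "d < min k (n - k)" for d
  proof (rule sum.reindex_bij_witness[of _ int nat])
    fix r assume r: "r \<in> {1..int d + 1}"
    have e: "int n - int k - int d - 1 = int (n - k - d - 1)" "int k - r + 1 = int (k - nat r + 1)"
      "int k - int d = int (k - d)"
      using r d by auto
    show "int (k - d) * ext_binom (int d - 1) (int (nat r) - 2) *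
        int ((n - k - d - 1) div (k - nat r + 1) + 1) =
      (int k - int d) * ext_binom (int d - 1) (r - 2) *
       (\<lfloor>real_of_int (int n - int k - int d - 1) / real_of_int (int k - r + 1)\<rfloor> + 1)"
      unfolding e floor_divide_of_int_eq zdiv_int[symmetric] using r by simp
  qed auto
  have "(\<Sum>\<Delta> = 0..min (int k - 1) (int n - int k - 1). \<Sum>r = 1..\<Delta> + 1.
     (int k - \<Delta>) * ext_binom (\<Delta> - 1) (r - 2) *
     (\<lfloor>real_of_int (int n - int k - \<Delta> - 1) / real_of_int (int k - r + 1)\<rfloor> + 1))
    = (\<Sum>d<min k (n - k). \<Sum>r = 1..int d + 1. (int k - int d) * ext_binom (int d - 1) (r - 2) *
     (\<lfloor>real_of_int (int n - int k - int d - 1) / real_of_int (int k - r + 1)\<rfloor> + 1))"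
    by (rule sum.reindex_bij_witness[of _ int nat]) (use assms in auto)
  also have "\<dots> = (\<Sum>d<min k (n - k). \<Sum>r=1..d + 1.
     int (k - d) * ext_binom (int d - 1) (int r - 2) *
     int ((n - k - d - 1) div (k - r + 1) + 1))"
    by (intro sum.cong refl inner) auto
  finally show ?thesis unfolding m1_def by simp
qed

section \<open>An injection from the choices of \<open>Q\<close> and a block into the required
  bases\<close>

theorem theorem3p5:
  fixes n k :: nat and \<B> :: "nat set set"
  assumes "2 \<le> n"
    and "cyclic_matroid n k \<B>"
  shows "m1 n k \<le> int (card {A \<in> \<B>. \<exists>Q P i. 1 \<le> i \<and> i \<le> n - 1 \<and>
           Q \<subseteq> cyc_block n k 0 \<and> P \<subseteq> cyc_block n k i \<and>
           A = (cyc_block n k 0 - Q) \<union> P})"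
proof -
  note M = assms(2)
  have n: "0 < n" using assms(1) by simp
  have B0: "{0..<k} \<in> \<B>" by (rule initial_block_in_cyclic_matroid[OF M n])
  have kn: "k \<le> n" by (rule cyclic_matroid_rank_le[OF M B0])
  have block0: "cyc_block n k 0 = {0..<k}"
  proof -
    have "cyc_block n k 0 = (\<lambda>t. t) ` {0..<k}"
      unfolding cyc_block_def using kn by (intro image_cong) auto
    then show ?thesis by simp
  qed
  define S where "S = {A \<in> \<B>. \<exists>Q P i. 1 \<le> i \<and> i \<le> n - 1 \<and>
           Q \<subseteq> cyc_block n k 0 \<and> P \<subseteq> cyc_block n k i \<and>
           A = (cyc_block n k 0 - Q) \<union> P}"
  \<comment> \<open>For a basis within the two blocks, the witnesses are the part of
    \<open>{0..<k}\<close> that it misses and its part in the second block.\<close>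
  have S_I: "A \<in> S" if "A \<in> \<B>" "1 \<le> i" "i \<le> n - 1" "A \<subseteq> {0..<k} \<union> cyc_block n k i" for A i
  proof -
    have "A = ({0..<k} - ({0..<k} - A)) \<union> (A \<inter> cyc_block n k i)" using that(4) by blast
    moreover have "{0..<k} - A \<subseteq> {0..<k}" "A \<inter> cyc_block n k i \<subseteq> cyc_block n k i" by auto
    ultimately have "\<exists>Q P i. 1 \<le> i \<and> i \<le> n - 1 \<and> Q \<subseteq> {0..<k} \<and> P \<subseteq> cyc_block n k i \<and>
        A = ({0..<k} - Q) \<union> P"
      using that(2,3)
      by - (rule exI[of _ "{0..<k} - A"], rule exI[of _ "A \<inter> cyc_block n k i"], rule exI[of _ i], simp)
    then show ?thesis unfolding S_def block0 using that(1) by simp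
  qed
  have finS: "finite S"
    by (rule finite_subset[of _ "Pow {0..<n}"])
      (use M in \<open>auto simp: S_def cyclic_matroid_def matroid_bases_def\<close>)
  have B0S: "{0..<k} \<in> S" using S_I[OF B0, of 1] assms(1) by auto
  define h where "h d r = (n - k - d - 1) div (k - r + 1)" for d r
  \<comment> \<open>The first block starts right after the maximum of \<open>Q\<close>. The stride
    \<open>k - r + 1\<close> leaves an overlap of at most \<open>r - 1\<close> between different
    blocks, and \<open>h d r\<close> is the last index for which the block still ends before
    \<open>n + q\<close>.\<close>
  define blk where "blk d r q t = q + d + 1 + t * (k - r + 1)" for d r q t
  \<comment> \<open>The range of \<open>q\<close> ensures \<open>q + d < k\<close>, hence
    \<open>Q \<subseteq> {0..<k}\<close>; it yields the factor \<open>k - d\<close>.\<close>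
  define T where "T = (SIGMA d:{..<min k (n - k)}. SIGMA r:{1..d + 1}. SIGMA q:{..<k - d}.
      spanning_subsets d r q \<times> {..h d r})"
  have blk: "q + d < blk d r q t" "blk d r q t + k \<le> n + q"
    if "d < min k (n - k)" "t \<le> h d r" for d r q t
  proof -
    show "q + d < blk d r q t" by (simp add: blk_def)
    have "t * (k - r + 1) \<le> h d r * (k - r + 1)" using that(2) by (rule mult_le_mono1)
    also have "\<dots> \<le> n - k - d - 1" unfolding h_def by (rule div_times_less_eq_dividend)
    finally show "blk d r q t + k \<le> n + q" using that(1) unfolding blk_def by linarith
  qed
  have "\<exists>C\<in>\<B>. {0..<k} - C = Q \<and> C \<subseteq> {0..<k} \<union> cyc_block n k (blk d r q t)"
    if "(d, r, q, Q, t) \<in> T" for d r q Q t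
    by (rule exchange_with_cyc_block[OF M, of _ q d])
      (use that blk[of d t r q] in \<open>auto simp: T_def spanning_subsets_def\<close>)
  then have "\<forall>x\<in>T. \<exists>C. case x of (d, r, q, Q, t) \<Rightarrow>
      C \<in> \<B> \<and> {0..<k} - C = Q \<and> C \<subseteq> {0..<k} \<union> cyc_block n k (blk d r q t)"
    by blast
  then obtain f where "\<forall>x\<in>T. case x of (d, r, q, Q, t) \<Rightarrow>
      f x \<in> \<B> \<and> {0..<k} - f x = Q \<and> f x \<subseteq> {0..<k} \<union> cyc_block n k (blk d r q t)"
    by (rule bchoice[THEN exE])
  then have f: "f (d, r, q, Q, t) \<in> \<B>" "{0..<k} - f (d, r, q, Q, t) = Q"
      "f (d, r, q, Q, t) \<subseteq> {0..<k} \<union> cyc_block n k (blk d r q t)"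
    if "(d, r, q, Q, t) \<in> T" for d r q Q t
    using that by auto
  \<comment> \<open>For \<open>t < t'\<close> the blocks would share at most \<open>r - 1\<close>
    elements, while the basis misses the \<open>r\<close> elements of \<open>Q\<close>. Exchanging
    the roles of \<open>t\<close> and \<open>t'\<close> gives equality.\<close>
  have t_le: "t' \<le> t" if T: "(d, r, q, Q, t) \<in> T" "(d, r, q, Q, t') \<in> T"
      and eq: "f (d, r, q, Q, t) = f (d, r, q, Q, t')" for d r q Q t t'
  proof (rule ccontr)
    assume "\<not> t' \<le> t"
    then have "Suc t * (k - r + 1) \<le> t' * (k - r + 1)" by (intro mult_le_mono1) simp
    then have step: "blk d r q t + (k - r + 1) \<le> blk d r q t'" unfolding blk_def by simp
    have rk: "1 \<le> r" "r \<le> k" "card Q = r"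
      using T(1) unfolding T_def spanning_subsets_def by auto
    have "card ({0..<k} - f (d, r, q, Q, t)) \<le> blk d r q t + k - blk d r q t'"
      by (rule exchange_block_unique[OF M f(1)[OF T(1)] f(3)[OF T(1)] f(3)[OF T(2), folded eq], of q])
        (use T blk[of d t r q] blk[of d t' r q] step in \<open>auto simp: T_def\<close>)
    then show False using f(2)[OF T(1)] rk step by simp
  qed
  have "inj_on f T"
  proof (rule inj_onI)
    fix x y assume xy: "x \<in> T" "y \<in> T" "f x = f y"
    obtain d r q Q t where x: "x = (d, r, q, Q, t)" by (cases x) auto
    obtain d' r' q' Q' t' where y: "y = (d', r', q', Q', t')" by (cases y) auto
    \<comment> \<open>The basis determines \<open>Q\<close> as its complement in
      \<open>{0..<k}\<close>; then \<open>r\<close>, \<open>q\<close> and \<open>d\<close> are read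
      off from the size, minimum and maximum of \<open>Q\<close>.\<close>
    have Q: "Q' = Q" using f(2) xy unfolding x y by metis
    have sp: "Q \<in> spanning_subsets d r q" "Q \<in> spanning_subsets d' r' q'"
      using xy(1,2) Q unfolding x y T_def by auto
    have "r' = r" using sp unfolding spanning_subsets_def by simp
    moreover have "q' = q" "d' = d"
      using spanning_subsets_Min_Max[OF sp(1)] spanning_subsets_Min_Max[OF sp(2)] by auto
    ultimately show "x = y" using Q t_le xy unfolding x y by (metis le_antisym)
  qed
  \<comment> \<open>Each \<open>Q\<close> is nonempty, so the initial block is never an image; it
    supplies the summand 1 of \<open>m1\<close>.\<close>
  moreover have "f ` T \<subseteq> S - {{0..<k}}"
  proof (rule image_subsetI)
    fix x assume "x \<in> T"
    moreover obtain d r q Q t where x: "x = (d, r, q, Q, t)" by (cases x) auto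
    ultimately have T: "(d, r, q, Q, t) \<in> T" by simp
    have m: "d < min k (n - k)" "t \<le> h d r" "q < k - d" "q \<in> Q"
      using T unfolding T_def spanning_subsets_def by auto
    have "f x \<in> S" unfolding x
      by (rule S_I[OF f(1)[OF T] _ _ f(3)[OF T]]) (use m blk[OF m(1,2), of q] in auto)
    moreover have "f x \<noteq> {0..<k}" using f(2)[OF T] m(4) unfolding x by auto
    ultimately show "f x \<in> S - {{0..<k}}" by simp
  qed
  ultimately have "card T \<le> card (S - {{0..<k}})" using finS by (intro card_inj_on_le) auto
  also have "\<dots> = card S - 1" using B0S by simp
  finally have TS: "card T + 1 \<le> card S" using B0S finS card_gt_0_iff[of S] by fastforce
  have cardT: "card T = (\<Sum>d<min k (n - k). \<Sum>r=1..d + 1. \<Sum>q<k - d.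
      card (spanning_subsets d r q) * (h d r + 1))"
    unfolding T_def by (simp add: card_SigmaI finite_spanning_subsets card_cartesian_product)
  have "m1 n k \<le> 1 + int (card T)"
    unfolding m1_eq_nat_sum[OF kn] cardT of_nat_sum
  proof (intro add_left_mono sum_mono)
    fix d r :: nat assume r: "r \<in> {1..d + 1}"
    have "int (k - d) * ext_binom (int d - 1) (int r - 2) * int ((n - k - d - 1) div (k - r + 1) + 1)
      = (\<Sum>q<k - d. ext_binom (int d - 1) (int r - 2) * int (h d r + 1))"
      by (simp add: h_def)
    also have "\<dots> \<le> (\<Sum>q<k - d. int (card (spanning_subsets d r q) * (h d r + 1)))"
      unfolding of_nat_mult
      using r by (intro sum_mono mult_right_mono ext_binom_le_card_spanning_subsets) auto
    finally show "int (k - d) * ext_binom (int d - 1) (int r - 2) *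
        int ((n - k - d - 1) div (k - r + 1) + 1)
      \<le> (\<Sum>q<k - d. int (card (spanning_subsets d r q) * (h d r + 1)))" .
  qed
  then show ?thesis using TS unfolding S_def by linarith
qed

end
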